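(* Let $K$ be a field, $n\ge 1$, and $f(X,Y)=a_0(X)+a_1(X)Y+\cdots+a_n(X)Y^n\in K[X,Y]$, with $a_0,\dots,a_n\in K[X]$, $a_0a_n\neq 0$. Assume that for two polynomials $a(X),b(X)\in K[X]$ we have $f(X,a(X))f(X,b(X))\neq 0$ and $$\Delta:=\tfrac12\left(\deg f(X,b(X))-\deg f(X,a(X))\right)\ge 0,$$ and let $$q_u=\max\{\deg d_2-\deg d_1\le\Delta\;:\; d_1\in\mathcal{D}_u(f(X,a(X))),\ d_2\in\mathcal{D}_u(f(X,b(X)))\}.$$ If $\gcd\left(f(X,a(X)),\frac{\partial f}{\partial Y}(X,a(X))\right)=1$, $\gcd\left(f(X,b(X)),\frac{\partial f}{\partial Y}(X,b(X))\right)=1$ and $$\deg b(X)>\max\left\{\deg a(X),\ \max_{0\le i\le n-1}\frac{\deg a_i-\deg a_n}{n-i}\right\}+q_u,$$ then $f(X,Y)$, viewed as a polynomial in $Y$, is irreducible over $K(X)$.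
   Context: Unitary divisors: for $f(X,Y)\in K[X,Y]$ and $a(X)\in K[X]$ with $f(X,a(X))\neq 0$, the set of unitary divisors of $f(X,a(X))$ is $$\mathcal{D}_u(f(X,a(X)))=\left\{d\in K[X]: d(X)\mid f(X,a(X)),\ \gcd\left(d(X),\frac{f(X,a(X))}{d(X)}\right)=1\right\}.$$ All degrees are in $X$, and the zero polynomial has degree $-\infty$. *)

theory Defs
  imports "HOL-Computational_Algebra.Computational_Algebra" "HOL-Library.Extended_Real"
begin

(* A polynomial f in K[X,Y] has type 'k poly poly: the outer variable is Y and the
   coefficients are polynomials in X.  So f(X,a(X)) is "poly f a", and the partial
   derivative of f with respect to Y is "pderiv f". *)

(* Degree in X with the convention deg 0 = -infinity; the library's degree has degree 0 = 0. *)
definition xdeg :: "'k::zero poly \<Rightarrow> ereal" where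
  "xdeg p = (if p = 0 then - \<infinity> else ereal (real (degree p)))"

(* Only used for p \<noteq> 0; then d \<noteq> 0, and p div d is the exact quotient. *)
definition unitary_divisors :: "'k::field poly \<Rightarrow> 'k poly set" where
  "unitary_divisors p = {d. d dvd p \<and> coprime d (p div d)}"

(* Only used when poly f a and poly f b are both nonzero. *)
definition Delta :: "'k::field poly poly \<Rightarrow> 'k poly \<Rightarrow> 'k poly \<Rightarrow> real" where
  "Delta f a b = (real (degree (poly f b)) - real (degree (poly f a))) / 2"

(* When poly f a and poly f b are nonzero and Delta f a b \<ge> 0, this set is finite (the
   differences are bounded) and contains 0 (take d1 = d2 = 1), so Max is a genuine maximum. *)
definition q_u :: "'k::field poly poly \<Rightarrow> 'k poly \<Rightarrow> 'k poly \<Rightarrow> int" where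
  "q_u f a b = Max {int (degree d2) - int (degree d1) | d1 d2.
      d1 \<in> unitary_divisors (poly f a) \<and> d2 \<in> unitary_divisors (poly f b) \<and>
      real_of_int (int (degree d2) - int (degree d1)) \<le> Delta f a b}"

end

theory Submission
  imports Defs
begin

text \<open>
  By Gauss's lemma a nontrivial factorization over \<open>K(X)\<close> gives \<open>f = g h\<close> in \<open>K[X][Y]\<close>. Since
  \<open>f(a)\<close> is coprime to \<open>f'(a) = g'(a) h(a) + g(a) h'(a)\<close>, the values \<open>g(a)\<close> and \<open>h(a)\<close> are unitary
  divisors of \<open>f(a)\<close>, and likewise at \<open>b\<close>. The two increments \<open>deg g(b) - deg g(a)\<close> and
  \<open>deg h(b) - deg h(a)\<close> add up to twice \<open>Delta\<close>, so one of them, say the first, is at most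
  \<open>Delta\<close> and hence at most \<open>q_u\<close>.

  On the other hand, let \<open>r\<close> be the maximum in the hypothesis on \<open>deg b\<close>. For the weight that
  gives \<open>Y\<close> the degree \<open>r\<close>, the leading term of \<open>f\<close> has maximal weight; weighted degrees are
  additive, so the same holds for \<open>g\<close>. Consequently
  \<open>deg g(b) - deg g(a) \<ge> deg\<^sub>Y g \<cdot> (deg b - r) > q_u\<close>. This replaces the comparison of \<open>a\<close> and \<open>b\<close> with
  the roots of \<open>g\<close> in an algebraic closure of \<open>K(X)\<close>.
\<close>

section \<open>Gauss's lemma: from factorizations over \<open>K(X)\<close> to factorizations in
  \<open>K[X][Y]\<close>\<close>

lemma clear_denominators:
  fixes G :: "'a::idom fract poly"
  obtains d g where "d \<noteq> 0" "smult (to_fract d) G = map_poly to_fract g"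
proof -
  have "\<exists>d g. d \<noteq> 0 \<and> smult (to_fract d) G = map_poly to_fract g"
  proof (induction G)
    case 0
    show ?case by (rule exI[of _ 1], rule exI[of _ 0]) simp
  next
    case (pCons x G)
    then obtain d g where dg: "d \<noteq> 0" "smult (to_fract d) G = map_poly to_fract g"
      by blast
    obtain u v where x: "x = Fract u v" "v \<noteq> 0"
      by (cases x) auto
    have "to_fract v * x = to_fract u"
      using x by (simp add: Fract_conv_to_fract)
    then have "to_fract (v * d) * x = to_fract (d * u)"
      by (metis mult.commute mult.left_commute to_fract_mult)
    moreover have "smult (to_fract (v * d)) G = map_poly to_fract (smult v g)"
      using dg(2) by (metis fract_poly_smult smult_smult to_fract_mult)
    ultimately have "smult (to_fract (v * d)) (pCons x G)
        = map_poly to_fract (pCons (d * u) (smult v g))"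
      by (simp add: map_poly_pCons)
    then show ?case
      using x(2) dg(1) by (metis no_zero_divisors)
  qed
  then show ?thesis using that by blast
qed

lemma poly_irreducible_divisor_exists:
  fixes p :: "'a::field poly"
  assumes "degree p > 0"
  obtains q where "irreducible q" "q dvd p"
proof -
  have "\<exists>q. irreducible q \<and> q dvd p"
    using assms
  proof (induction "degree p" arbitrary: p rule: less_induct)
    case less
    show ?case
    proof (cases "irreducible p")
      case False
      have "p \<noteq> 0" using less.prems by auto
      moreover from this have "\<not> is_unit p"
        using less.prems by (simp add: is_unit_iff_degree)
      ultimately obtain s t where st: "p = s * t" "\<not> is_unit s" "\<not> is_unit t"
        using False by (auto simp: irreducible_def)
      then have nz: "s \<noteq> 0" "t \<noteq> 0"
        using \<open>p \<noteq> 0\<close> by auto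
      then have "degree s > 0" "degree t > 0"
        using st by (auto simp: is_unit_iff_degree)
      then have "degree s < degree p"
        using nz st by (simp add: degree_mult_eq)
      then obtain q where "irreducible q" "q dvd s"
        using less.hyps \<open>degree s > 0\<close> by blast
      then show ?thesis
        using st(1) by auto
    qed auto
  qed
  then show ?thesis using that by blast
qed

text \<open>Gauss's lemma without contents: the irreducible factors \<open>q\<close> of
  \<open>d\<close> are removed one at a time. Each \<open>[:q:]\<close> is prime in
  \<open>K[X][Y]\<close>, so it divides \<open>g\<close> or \<open>h\<close>, and dividing it out
  leaves the degree in \<open>Y\<close> unchanged.\<close>

lemma poly_poly_cancel_smult:
  fixes p g h :: "'a::field poly poly"
  assumes "d \<noteq> 0" "smult d p = g * h"
  obtains g' h' where "p = g' * h'" "degree g' = degree g" "degree h' = degree h"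
proof -
  have "\<exists>g' h'. p = g' * h' \<and> degree g' = degree g \<and> degree h' = degree h"
    using assms
  proof (induction "degree d" arbitrary: d g h rule: less_induct)
    case less
    show ?case
    proof (cases "degree d = 0")
      case True
      then obtain k where k: "d = [:k:]" by (rule degree_eq_zeroE)
      with less.prems(1) have "k \<noteq> 0" by simp
      \<comment> \<open>With no irreducible factor left, \<open>d\<close> is a nonzero constant of
        \<open>K\<close>, and its inverse is absorbed into \<open>g\<close>.\<close>
      then have "[:inverse k:] * d = 1"
        by (simp add: k one_pCons)
      then have "p = smult [:inverse k:] (smult d p)"
        by simp
      also have "\<dots> = smult [:inverse k:] g * h"
        by (simp add: less.prems(2))
      finally have "p = smult [:inverse k:] g * h" .
      then show ?thesis
        using \<open>k \<noteq> 0\<close> by (intro exI[of _ "smult [:inverse k:] g"] exI[of _ h]) simp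
    next
      case False
      then obtain q where q: "irreducible q" "q dvd d"
        using poly_irreducible_divisor_exists[of d] by auto
      then have prime: "prime_elem [:q:]"
        by (intro lift_prime_elem_poly field_poly_irreducible_imp_prime)
      from q obtain e where e: "d = q * e" by blast
      have q0: "q \<noteq> 0" "e \<noteq> 0" using less.prems(1) e by auto
      have "degree q > 0"
        using q(1) q0 by (auto simp: irreducible_def is_unit_iff_degree)
      then have deg: "degree e < degree d"
        using e q0 by (simp add: degree_mult_eq)
      have gh: "g * h = [:q:] * smult e p"
        using less.prems(2) e by (simp add: mult.commute)
      then have "[:q:] dvd g \<or> [:q:] dvd h"
        using prime by (metis dvd_triv_left prime_elem_dvd_mult_iff)
      then show ?thesis
      proof
        assume "[:q:] dvd g"
        then obtain g1 where g1: "g = [:q:] * g1" by blast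
        with gh have "[:q:] * smult e p = [:q:] * (g1 * h)"
          by (metis mult.assoc)
        then have "smult e p = g1 * h"
          using q0 by (metis mult_cancel_left pCons_eq_0_iff)
        then show ?thesis
          using less.hyps[OF deg q0(2), of g1 h] g1 q0 by simp
      next
        assume "[:q:] dvd h"
        then obtain h1 where h1: "h = [:q:] * h1" by blast
        with gh have "[:q:] * smult e p = [:q:] * (g * h1)"
          by (metis mult.left_commute)
        then have "smult e p = g * h1"
          using q0 by (metis mult_cancel_left pCons_eq_0_iff)
        then show ?thesis
          using less.hyps[OF deg q0(2), of g h1] h1 q0 by simp
      qed
    qed
  qed
  then show ?thesis using that by blast
qed

lemma fract_poly_factorization_descends:
  fixes p :: "'a::field poly poly"
  assumes "map_poly to_fract p = G * H"
  obtains g h where "p = g * h" "degree g = degree G" "degree h = degree H"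
proof -
  obtain d g where dg: "d \<noteq> 0" "smult (to_fract d) G = map_poly to_fract g"
    by (rule clear_denominators)
  obtain e h where eh: "e \<noteq> 0" "smult (to_fract e) H = map_poly to_fract h"
    by (rule clear_denominators)
  have degs: "degree g = degree G" "degree h = degree H"
    using arg_cong[OF dg(2), of degree] arg_cong[OF eh(2), of degree] dg(1) eh(1)
    by (simp_all add: degree_map_poly)
  have "map_poly to_fract (smult (d * e) p) = map_poly to_fract (g * h)"
    using assms
    by (simp add: dg(2)[symmetric] eh(2)[symmetric] mult_ac
        del: fract_poly_eq_iff)
  then have "smult (d * e) p = g * h"
    by (simp only: fract_poly_eq_iff)
  then show ?thesis
    using poly_poly_cancel_smult[of "d * e" p g h] dg(1) eh(1) degs that by auto
qed

text \<open>Over \<open>K(X)\<close> the units are exactly the nonzero polynomials of degree 0 in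
  \<open>Y\<close>, so a factor of \<open>p\<close> lying in \<open>K[X]\<close> does no harm and
  only degrees in \<open>Y\<close> have to be excluded.\<close>

lemma irreducible_fract_polyI:
  fixes p :: "'a::field poly poly"
  assumes "degree p > 0"
    and "\<And>g h. p = g * h \<Longrightarrow> degree g > 0 \<Longrightarrow> degree h > 0 \<Longrightarrow> False"
  shows "irreducible (map_poly to_fract p)"
proof (rule irreducibleI)
  have deg: "degree (map_poly to_fract p) = degree p"
    by (simp add: degree_map_poly)
  show nz: "map_poly to_fract p \<noteq> 0"
    using assms(1) by auto
  show "\<not> is_unit (map_poly to_fract p)"
    using assms(1) deg nz by (simp add: is_unit_iff_degree)
  fix G H assume GH: "map_poly to_fract p = G * H"
  obtain g h where gh: "p = g * h" "degree g = degree G" "degree h = degree H"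
    using fract_poly_factorization_descends[OF GH] .
  then have "degree g = 0 \<or> degree h = 0"
    using assms(2) by blast
  moreover have "G \<noteq> 0" "H \<noteq> 0"
    using GH nz by auto
  ultimately show "is_unit G \<or> is_unit H"
    using gh by (auto simp: is_unit_iff_degree)
qed

section \<open>Weighted degrees and their additivity\<close>

lemma degree_sum_dominant:
  fixes F :: "'i \<Rightarrow> 'a::comm_monoid_add poly"
  assumes "finite S" "s \<in> S" "F s \<noteq> 0"
    and "\<And>t. t \<in> S \<Longrightarrow> t \<noteq> s \<Longrightarrow> F t = 0 \<or> degree (F t) < degree (F s)"
  shows "sum F S \<noteq> 0" and "degree (F s) \<le> degree (sum F S)"
proof -
  \<comment> \<open>No other summand reaches this degree, so nothing can cancel the leading
    coefficient of \<open>F s\<close>.\<close>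
  have "coeff (F t) (degree (F s)) = 0" if "t \<in> S - {s}" for t
    using assms(4)[of t] that by (auto simp: coeff_eq_0)
  then have rest: "(\<Sum>t\<in>S - {s}. coeff (F t) (degree (F s))) = 0"
    by (rule sum.neutral[OF ballI])
  have "coeff (sum F S) (degree (F s)) = (\<Sum>t\<in>S. coeff (F t) (degree (F s)))"
    by (simp add: coeff_sum)
  also have "\<dots> = lead_coeff (F s)"
    using rest by (subst sum.remove[OF assms(1,2)]) simp
  finally have "coeff (sum F S) (degree (F s)) \<noteq> 0"
    using assms(3) by simp
  then show "sum F S \<noteq> 0" "degree (F s) \<le> degree (sum F S)"
    by (auto intro: le_degree)
qed

text \<open>The degree of the \<open>i\<close>-th term of \<open>p\<close> when \<open>Y\<close>
  counts with degree \<open>r\<close>. It is meaningful only if \<open>coeff p i\<close> is nonzero,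
  because \<open>degree 0 = 0\<close>.\<close>

definition term_weight :: "real \<Rightarrow> 'a::zero poly poly \<Rightarrow> nat \<Rightarrow> real" where
  "term_weight r p i = real (degree (coeff p i)) + real i * r"

text \<open>Taking the last index of maximal weight breaks ties, so that in a product exactly one
  pair of terms attains the maximal weight at the sum of the two chosen indices.\<close>

lemma last_heaviest_term:
  assumes "p \<noteq> 0"
  obtains i where "coeff p i \<noteq> 0"
    "\<And>j. coeff p j \<noteq> 0 \<Longrightarrow> term_weight r p j \<le> term_weight r p i"
    "\<And>j. coeff p j \<noteq> 0 \<Longrightarrow> j > i \<Longrightarrow> term_weight r p j < term_weight r p i"
proof -
  define S where "S = {j. coeff p j \<noteq> 0}"
  have fin: "finite S"
    unfolding S_def by (rule finite_subset[of _ "{..degree p}"]) (auto intro: le_degree)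
  have ne: "S \<noteq> {}"
    using assms by (auto simp: S_def poly_eq_iff)
  define w where "w = Max (term_weight r p ` S)"
  define T where "T = {j \<in> S. term_weight r p j = w}"
  have "w \<in> term_weight r p ` S"
    unfolding w_def using fin ne by (intro Max_in) auto
  then have "T \<noteq> {}" by (auto simp: T_def)
  moreover have finT: "finite T" using fin by (simp add: T_def)
  ultimately have m: "Max T \<in> T" by simp
  have le: "term_weight r p j \<le> w" if "j \<in> S" for j
    unfolding w_def using fin that by simp
  show ?thesis
  proof (rule that[of "Max T"])
    show "coeff p (Max T) \<noteq> 0"
      using m by (simp add: T_def S_def)
    fix j assume "coeff p j \<noteq> 0"
    then have j: "j \<in> S" by (simp add: S_def)
    show "term_weight r p j \<le> term_weight r p (Max T)"
      using le[OF j] m by (simp add: T_def)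
    assume "Max T < j"
    then have "j \<notin> T"
      using finT Max_ge leD by blast
    then show "term_weight r p j < term_weight r p (Max T)"
      using le[OF j] j m by (auto simp: T_def)
  qed
qed

text \<open>The last heaviest terms of \<open>g\<close> and \<open>h\<close>, at \<open>i\<close>
  and \<open>l\<close>, produce a term of \<open>g * h\<close> whose weight is at least the sum of
  both maxima. By \<open>heaviest\<close> this is at most the weight of the leading term of
  \<open>g * h\<close>, which is the sum of the weights of the two leading terms. Hence both leading
  terms attain their maxima.\<close>

lemma lead_term_heaviest_factor:
  fixes g h :: "'a::idom poly poly"
  assumes "g \<noteq> 0" "h \<noteq> 0"
    and heaviest: "\<And>i. coeff (g * h) i \<noteq> 0 \<Longrightarrow>
      term_weight r (g * h) i \<le> term_weight r (g * h) (degree (g * h))"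
    and "coeff g k \<noteq> 0"
  shows "term_weight r g k \<le> term_weight r g (degree g)"
proof -
  obtain i where i: "coeff g i \<noteq> 0"
    "\<And>j. coeff g j \<noteq> 0 \<Longrightarrow> term_weight r g j \<le> term_weight r g i"
    "\<And>j. coeff g j \<noteq> 0 \<Longrightarrow> j > i \<Longrightarrow> term_weight r g j < term_weight r g i"
    using last_heaviest_term[OF assms(1)] by metis
  obtain l where l: "coeff h l \<noteq> 0"
    "\<And>j. coeff h j \<noteq> 0 \<Longrightarrow> term_weight r h j \<le> term_weight r h l"
    "\<And>j. coeff h j \<noteq> 0 \<Longrightarrow> j > l \<Longrightarrow> term_weight r h j < term_weight r h l"
    using last_heaviest_term[OF assms(2)] by metis
  let ?F = "\<lambda>t. coeff g t * coeff h (i + l - t)"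
  have dom: "?F t = 0 \<or> degree (?F t) < degree (?F i)" if "t \<in> {..i + l}" "t \<noteq> i" for t
  proof (cases "?F t = 0")
    case False
    then have nz: "coeff g t \<noteq> 0" "coeff h (i + l - t) \<noteq> 0" by auto
    \<comment> \<open>The indices add up to \<open>i + l\<close>, so one of them lies beyond its
      last heaviest index. That factor loses weight strictly and the other cannot gain; the common
      part \<open>(i + l) * r\<close> then cancels, leaving a comparison of degrees.\<close>
    have "t > i \<or> i + l - t > l" using that by auto
    then have "term_weight r g t + term_weight r h (i + l - t)
        < term_weight r g i + term_weight r h l"
      using i(2)[OF nz(1)] l(2)[OF nz(2)] i(3)[OF nz(1)] l(3)[OF nz(2)] by auto
    then have "real (degree (coeff g t) + degree (coeff h (i + l - t)))
        < real (degree (coeff g i) + degree (coeff h l))"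
      using that by (simp add: term_weight_def of_nat_diff algebra_simps)
    then show ?thesis
      using nz i(1) l(1) by (simp add: degree_mult_eq)
  qed simp
  have F_i: "?F i \<noteq> 0"
    using i(1) l(1) by simp
  have "coeff (g * h) (i + l) \<noteq> 0"
    and "degree (?F i) \<le> degree (coeff (g * h) (i + l))"
    unfolding coeff_mult using degree_sum_dominant[of "{..i + l}" i ?F, OF _ _ F_i dom] by simp_all
  moreover have "degree (?F i) = degree (coeff g i) + degree (coeff h l)"
    using i(1) l(1) by (simp add: degree_mult_eq)
  ultimately have "term_weight r g i + term_weight r h l \<le> term_weight r (g * h) (degree (g * h))"
    using heaviest[of "i + l"] by (simp add: term_weight_def algebra_simps)
  also have "\<dots> = term_weight r g (degree g) + term_weight r h (degree h)"
    using assms(1,2)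
    by (simp add: term_weight_def degree_mult_eq lead_coeff_mult coeff_mult_degree_sum
        algebra_simps)
  finally show ?thesis
    using i(2)[OF assms(4)] l(2)[of "degree h"] assms(2) by simp
qed

section \<open>Degrees of the values of a polynomial in \<open>Y\<close>\<close>

lemma degree_sum_le_real:
  fixes F :: "'i \<Rightarrow> 'a::comm_monoid_add poly"
  assumes "\<And>t. t \<in> S \<Longrightarrow> F t \<noteq> 0 \<Longrightarrow> real (degree (F t)) \<le> x" "sum F S \<noteq> 0"
  shows "real (degree (sum F S)) \<le> x"
proof -
  let ?T = "{t \<in> S. F t \<noteq> 0}"
  have fin: "finite S"
    using assms(2) sum.infinite by blast
  then have eq: "sum F S = sum F ?T"
    by (intro sum.mono_neutral_right) auto
  then have "?T \<noteq> {}"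
    using assms(2) by (intro notI) (simp only: sum.empty)
  then obtain t where "t \<in> S" "F t \<noteq> 0"
    by blast
  \<comment> \<open>A nonzero summand has degree at least 0 and at most \<open>x\<close>, so
    \<open>x\<close> can be rounded down to a natural number.\<close>
  then have "0 \<le> x"
    using assms(1)[of t] by linarith
  then have "degree (sum F ?T) \<le> nat \<lfloor>x\<rfloor>"
    using fin assms(1) by (intro degree_sum_le) (auto simp: le_nat_floor)
  then show ?thesis
    using \<open>0 \<le> x\<close> eq by (simp add: le_nat_iff le_floor_iff)
qed

text \<open>Since \<open>a\<close> has degree at most \<open>r\<close>, no term of
  \<open>poly p a\<close> exceeds the weight of the leading term; since \<open>b\<close> has degree
  above \<open>r\<close>, the leading term strictly dominates in \<open>poly p b\<close>. The two
  estimates differ by \<open>degree p\<close> times \<open>degree b - r\<close>.\<close>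

lemma degree_poly_increment:
  fixes p :: "'a::idom poly poly"
  assumes heaviest: "\<And>i. coeff p i \<noteq> 0 \<Longrightarrow> term_weight r p i \<le> term_weight r p (degree p)"
    and a: "a \<noteq> 0 \<Longrightarrow> real (degree a) \<le> r" "poly p a \<noteq> 0"
    and b: "b \<noteq> 0" "r < real (degree b)"
  shows "real (degree p) * (real (degree b) - r)
    \<le> real (degree (poly p b)) - real (degree (poly p a))"
proof -
  have p0: "p \<noteq> 0" using a(2) by auto
  have "real (degree (poly p a)) \<le> term_weight r p (degree p)"
    using a(2) unfolding poly_altdef
  proof (rule degree_sum_le_real[rotated])
    fix t assume nz: "coeff p t * a ^ t \<noteq> 0"
    have "real (degree (a ^ t)) \<le> real t * r"
    proof (cases "a = 0")
      case True
      \<comment> \<open>For \<open>a = 0\<close> only the constant term survives, so a negative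
        \<open>r\<close> is allowed.\<close>
      with nz have "t = 0" by (cases t) auto
      then show ?thesis by simp
    next
      case False
      then show ?thesis
        using a(1) by (simp add: degree_power_eq mult_left_mono)
    qed
    then have "real (degree (coeff p t * a ^ t)) \<le> term_weight r p t"
      using nz by (simp add: degree_mult_eq term_weight_def)
    also have "\<dots> \<le> term_weight r p (degree p)"
      using heaviest nz by auto
    finally show "real (degree (coeff p t * a ^ t)) \<le> term_weight r p (degree p)" .
  qed
  moreover
  let ?F = "\<lambda>t. coeff p t * b ^ t"
  have deg_F: "degree (?F t) = degree (coeff p t) + t * degree b" if "coeff p t \<noteq> 0" for t
    using that b(1) by (simp add: degree_mult_eq degree_power_eq)
  have "degree (?F (degree p)) \<le> degree (\<Sum>t\<le>degree p. ?F t)"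
  proof (rule degree_sum_dominant(2))
    show "?F (degree p) \<noteq> 0" using p0 b(1) by simp
    fix t assume t: "t \<in> {..degree p}" "t \<noteq> degree p"
    show "?F t = 0 \<or> degree (?F t) < degree (?F (degree p))"
    proof (cases "coeff p t = 0")
      case False
      \<comment> \<open>Raising the weight of \<open>Y\<close> from \<open>r\<close> to
        \<open>degree b\<close> favours the highest power and turns the weak inequality between
        weights into a strict one.\<close>
      have "(real (degree p) - real t) * r < (real (degree p) - real t) * real (degree b)"
        using t b(2) by (intro mult_strict_left_mono) auto
      then have "real (degree (coeff p t) + t * degree b)
          < real (degree (lead_coeff p) + degree p * degree b)"
        using heaviest[OF False] by (simp add: term_weight_def algebra_simps)
      then show ?thesis
        using deg_F[OF False] deg_F[of "degree p"] p0 by (simp only: of_nat_less_iff leading_coeff_0_iff) simp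
    qed simp
  qed auto
  then have "degree (lead_coeff p) + degree p * degree b \<le> degree (poly p b)"
    using deg_F[of "degree p"] p0 by (simp add: poly_altdef)
  then have "real (degree (lead_coeff p)) + real (degree p) * real (degree b)
      \<le> real (degree (poly p b))"
    by (metis of_nat_add of_nat_le_iff of_nat_mult)
  ultimately show ?thesis
    by (simp add: term_weight_def algebra_simps)
qed

section \<open>Unitary divisors and the bound \<open>q_u\<close>\<close>

lemma unitary_divisors_poly_factor:
  fixes g h :: "'a::field poly poly"
  assumes "coprime (poly (g * h) x) (poly (pderiv (g * h)) x)" "poly (g * h) x \<noteq> 0"
  shows "poly g x \<in> unitary_divisors (poly (g * h) x)"
proof -
  have "coprime (poly g x) (poly h x)"
  proof (rule coprimeI)
    fix c assume "c dvd poly g x" "c dvd poly h x"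
    then have "c dvd poly (g * h) x" "c dvd poly (pderiv (g * h)) x"
      by (simp_all add: pderiv_mult)
    then show "is_unit c"
      using assms(1) coprime_common_divisor by blast
  qed
  then show ?thesis
    using assms(2) by (auto simp: unitary_divisors_def)
qed

text \<open>A divisor of a nonzero polynomial has bounded degree, so the set of differences is
  finite and each member lies below its \<open>Max\<close>.\<close>

lemma q_u_upper:
  assumes "poly f a \<noteq> 0" "poly f b \<noteq> 0"
    and "d1 \<in> unitary_divisors (poly f a)" "d2 \<in> unitary_divisors (poly f b)"
    and "real (degree d2) - real (degree d1) \<le> Delta f a b"
  shows "real (degree d2) - real (degree d1) \<le> real_of_int (q_u f a b)"
proof -
  let ?S = "{int (degree d2) - int (degree d1) | d1 d2.
      d1 \<in> unitary_divisors (poly f a) \<and> d2 \<in> unitary_divisors (poly f b) \<and>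
      real_of_int (int (degree d2) - int (degree d1)) \<le> Delta f a b}"
  have bound: "degree d \<le> degree p" if "d \<in> unitary_divisors p" "p \<noteq> 0" for d p :: "'a poly"
    using that by (auto simp: unitary_divisors_def intro: dvd_imp_degree_le)
  have "?S \<subseteq> {- int (degree (poly f a))..int (degree (poly f b))}"
    using bound[OF _ assms(1)] bound[OF _ assms(2)] by fastforce
  then have "finite ?S"
    by (rule finite_subset) simp
  moreover have "int (degree d2) - int (degree d1) \<in> ?S"
    using assms by auto
  ultimately have "int (degree d2) - int (degree d1) \<le> q_u f a b"
    unfolding q_u_def by (rule Max_ge)
  then show ?thesis
    by linarith
qed

lemma q_u_nonneg:
  assumes "poly f a \<noteq> 0" "poly f b \<noteq> 0" "Delta f a b \<ge> 0"
  shows "q_u f a b \<ge> 0"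
  using q_u_upper[OF assms(1,2), of 1 1] assms(3) by (simp add: unitary_divisors_def)

section \<open>From the degree hypothesis to the contradiction between the two factors\<close>

theorem theorem4p1:
  fixes n :: nat
    and c :: "nat \<Rightarrow> 'k::field poly"
    and f :: "'k poly poly"
    and a b :: "'k poly"
  assumes "n \<ge> 1"
    and "f = (\<Sum>i\<le>n. monom (c i) i)"
    and "c 0 * c n \<noteq> 0"
    and "poly f a * poly f b \<noteq> 0"
    and "Delta f a b \<ge> 0"
    and "coprime (poly f a) (poly (pderiv f) a)"
    and "coprime (poly f b) (poly (pderiv f) b)"
    and "xdeg b > max (xdeg a)
           (MAX i\<in>{..n - 1}. (xdeg (c i) - xdeg (c n)) / ereal (real (n - i)))
         + ereal (real_of_int (q_u f a b))"
  shows "irreducible (map_poly to_fract f :: 'k poly fract poly)"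
proof -
  have c: "c 0 \<noteq> 0" "c n \<noteq> 0" and fa: "poly f a \<noteq> 0" and fb: "poly f b \<noteq> 0"
    using assms(3,4) by auto
  have coeff_f: "coeff f i = (if i \<le> n then c i else 0)" for i
    by (simp add: assms(2) coeff_sum)
  have deg_f: "degree f = n"
    using c by (intro antisym degree_le le_degree) (auto simp: coeff_f)
  let ?Q = "\<lambda>i. (xdeg (c i) - xdeg (c n)) / ereal (real (n - i))"
  define R where "R = max (xdeg a) (MAX i\<in>{..n - 1}. ?Q i)"
  have Q_R: "?Q i \<le> R" if "i < n" for i
  proof -
    have "?Q i \<le> (MAX i\<in>{..n - 1}. ?Q i)"
      using that by (intro Max_ge) auto
    then show ?thesis by (simp add: R_def le_max_iff_disj)
  qed
  have Q_fin: "?Q i = ereal ((real (degree (c i)) - real (degree (c n))) / real (n - i))"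
    if "i < n" "c i \<noteq> 0" for i
    using that c by (simp add: xdeg_def)
  have Q_lt: "?Q i < \<infinity>" if "i < n" for i
    using that c by (cases "c i = 0") (auto simp: xdeg_def)
  \<comment> \<open>\<open>R\<close> is a real number: no quotient is infinite from above because
    \<open>c n\<close> is nonzero, and the quotient at index 0 is finite because \<open>c 0\<close>
    is nonzero.\<close>
  have "(MAX i\<in>{..n - 1}. ?Q i) \<in> ?Q ` {..n - 1}"
    by (intro Max_in) auto
  then have "(MAX i\<in>{..n - 1}. ?Q i) < \<infinity>"
    using Q_lt assms(1) by fastforce
  then have "R < \<infinity>"
    unfolding R_def max_less_iff_conj by (simp add: xdeg_def)
  moreover have "R \<noteq> - \<infinity>"
    using Q_R[of 0] Q_fin[of 0] c assms(1) by auto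
  ultimately obtain r where r: "R = ereal r"
    by (cases R) auto
  have "ereal (r + real_of_int (q_u f a b)) < xdeg b"
    using assms(8) r unfolding R_def by simp
  then have b: "b \<noteq> 0" "r + real_of_int (q_u f a b) < real (degree b)"
    by (auto simp: xdeg_def split: if_splits)
  have "xdeg a \<le> ereal r"
    by (simp flip: r add: R_def)
  then have a: "real (degree a) \<le> r" if "a \<noteq> 0"
    using that by (simp add: xdeg_def)
  have q: "real_of_int (q_u f a b) \<ge> 0"
    using q_u_nonneg[OF fa fb assms(5)] by simp
  \<comment> \<open>Multiplying the bound on the \<open>i\<close>-th quotient by
    \<open>n - i\<close> gives exactly this comparison of weights.\<close>
  have heaviest: "term_weight r f i \<le> term_weight r f (degree f)" if "coeff f i \<noteq> 0" for i
  proof (cases "i < n")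
    case True
    then have "c i \<noteq> 0" using that by (simp add: coeff_f)
    then have "(real (degree (c i)) - real (degree (c n))) / real (n - i) \<le> r"
      using Q_R[OF True] Q_fin[OF True] r by simp
    then show ?thesis
      using True by (simp add: term_weight_def coeff_f deg_f field_simps of_nat_diff)
  next
    case False
    then have "i = n" using that by (auto simp: coeff_f split: if_splits)
    then show ?thesis by (simp add: deg_f)
  qed
  have increment: "real (degree (poly g b)) - real (degree (poly g a)) > Delta f a b"
    if gh: "f = g * h" "degree g > 0" for g h
  proof (rule ccontr)
    assume "\<not> ?thesis"
    then have le: "real (degree (poly g b)) - real (degree (poly g a)) \<le> real_of_int (q_u f a b)"
      using unitary_divisors_poly_factor[of g h a] unitary_divisors_poly_factor[of g h b]
        fa fb assms(6,7) gh(1)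
      by (intro q_u_upper) auto
    have "g \<noteq> 0" "h \<noteq> 0" "poly g a \<noteq> 0"
      using fa gh(1) by auto
    \<comment> \<open>As \<open>q_u\<close> is nonnegative, \<open>degree b - r\<close> is positive,
      so \<open>degree g\<close> may be replaced by its lower bound 1.\<close>
    have "1 * (real (degree b) - r) \<le> real (degree g) * (real (degree b) - r)"
      using gh(2) b q by (intro mult_right_mono) auto
    also have "\<dots> \<le> real (degree (poly g b)) - real (degree (poly g a))"
      using heaviest a b q \<open>g \<noteq> 0\<close> \<open>h \<noteq> 0\<close> \<open>poly g a \<noteq> 0\<close> unfolding gh(1)
      by (intro degree_poly_increment lead_term_heaviest_factor[of g h]) auto
    also note le
    finally show False
      using b by simp
  qed
  show ?thesis
  proof (rule irreducible_fract_polyI)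
    show "degree f > 0"
      using deg_f assms(1) by simp
    fix g h assume gh: "f = g * h" "degree g > 0" "degree h > 0"
    have "poly g a \<noteq> 0" "poly h a \<noteq> 0" "poly g b \<noteq> 0" "poly h b \<noteq> 0"
      using fa fb gh(1) by auto
    \<comment> \<open>Degrees add under multiplication at \<open>a\<close> and at \<open>b\<close>,
      whereas both increments on the right exceed \<open>Delta f a b\<close>.\<close>
    then have "2 * Delta f a b = real (degree (poly g b)) - real (degree (poly g a))
        + (real (degree (poly h b)) - real (degree (poly h a)))"
      by (simp add: Delta_def gh(1) degree_mult_eq)
    then show False
      using increment[of g h] increment[of h g] gh by (simp add: mult.commute)
  qed
qed

end
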